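(* Let $G(V,E)$ be a $k$-uniform hypergraph with $|V|=n$ and $E\neq\emptyset$, and let $M$ be a maximal matching of $G$. Then $\chi^c(G)\le \log_2|M|+2$. Moreover, there is an algorithm that, given $G$ and $M$, computes a bicoloring cover of $G$ of size at most $\log_2|M|+2$ in $O(n\log|M|)$ time.
   Context: A matching of $G$ is a set of pairwise disjoint hyperedges; it is maximal if no further hyperedge of $G$ can be added to it while keeping it a matching. A bicoloring is a map $X:V\to\{0,1\}$; a bicoloring cover of $G$ is a set of bicolorings such that every hyperedge is non-monochromatic under at least one of them; $\chi^c(G)$ is the minimum size of a bicoloring cover. *)

theory Defs
  imports Complex_Main "HOL-Library.FuncSet"
begin

section \<open>Hypergraphs, matchings and bicoloring covers\<close>

definition uniform_hypergraph :: "nat \<Rightarrow> 'a set \<Rightarrow> 'a set set \<Rightarrow> bool" where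
  "uniform_hypergraph k V E \<longleftrightarrow> finite V \<and> (\<forall>e\<in>E. e \<subseteq> V \<and> card e = k)"

definition matching :: "'a set set \<Rightarrow> 'a set set \<Rightarrow> bool" where
  "matching E M \<longleftrightarrow> M \<subseteq> E \<and> pairwise disjnt M"

definition maximal_matching :: "'a set set \<Rightarrow> 'a set set \<Rightarrow> bool" where
  "maximal_matching E M \<longleftrightarrow> matching E M \<and> (\<forall>e\<in>E - M. \<not> matching E (insert e M))"

text \<open>Bicolorings are extensional functions, so that a set of them has the intended cardinality.\<close>

definition bicolorings :: "'a set \<Rightarrow> ('a \<Rightarrow> nat) set" where
  "bicolorings V = V \<rightarrow>\<^sub>E {0, 1}"

definition monochromatic :: "('a \<Rightarrow> nat) \<Rightarrow> 'a set \<Rightarrow> bool" where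
  "monochromatic X e \<longleftrightarrow> (\<exists>c. \<forall>v\<in>e. X v = c)"

definition bicoloring_cover :: "'a set \<Rightarrow> 'a set set \<Rightarrow> ('a \<Rightarrow> nat) set \<Rightarrow> bool" where
  "bicoloring_cover V E \<X> \<longleftrightarrow>
     \<X> \<subseteq> bicolorings V \<and> (\<forall>e\<in>E. \<exists>X\<in>\<X>. \<not> monochromatic X e)"

text \<open>Meaningful only if a cover exists. For finite \<open>V\<close> this is the case iff every hyperedge
  has at least two vertices, since a hyperedge with fewer is monochromatic under every bicoloring.\<close>

definition bicoloring_cover_number :: "'a set \<Rightarrow> 'a set set \<Rightarrow> nat" where
  "bicoloring_cover_number V E =
     (LEAST c. \<exists>\<X>. finite \<X> \<and> bicoloring_cover V E \<X> \<and> card \<X> = c)"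


section \<open>Random access machine\<close>

text \<open>A unit-cost RAM with registers, indirectly addressed memory, addition and truncated
  subtraction, programmed with structured control flow. There is no multiplication, division or
  bit operation. A program mentions only finitely many registers. Conditionals and loops
  test whether a register is nonzero; each test costs one step.\<close>

datatype prog =
    Skip
  | Const nat nat
  | Move nat nat
  | Add nat nat nat
  | Sub nat nat nat
  | Load nat nat
  | Store nat nat
  | Seq prog prog
  | If nat prog prog
  | While nat prog

type_synonym state = "(nat \<Rightarrow> nat) \<times> (nat \<Rightarrow> nat)"  \<comment> \<open>registers, memory\<close>

text \<open>\<open>exec c s t s'\<close>: started in \<open>s\<close>, program \<open>c\<close> halts in \<open>s'\<close> after exactly \<open>t\<close> steps.\<close>

inductive exec :: "prog \<Rightarrow> state \<Rightarrow> nat \<Rightarrow> state \<Rightarrow> bool" where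
  Skip: "exec Skip s 1 s"
| Const: "exec (Const r c) (R, A) 1 (R(r := c), A)"
| Move: "exec (Move r p) (R, A) 1 (R(r := R p), A)"
| Add: "exec (Add r p q) (R, A) 1 (R(r := R p + R q), A)"
| Sub: "exec (Sub r p q) (R, A) 1 (R(r := R p - R q), A)"
| Load: "exec (Load r p) (R, A) 1 (R(r := A (R p)), A)"
| Store: "exec (Store p r) (R, A) 1 (R, A(R p := R r))"
| Seq: "exec c s t s' \<Longrightarrow> exec d s' u s'' \<Longrightarrow> exec (Seq c d) s (t + u) s''"
| IfTrue: "fst s r \<noteq> 0 \<Longrightarrow> exec c s t s' \<Longrightarrow> exec (If r c d) s (t + 1) s'"
| IfFalse: "fst s r = 0 \<Longrightarrow> exec d s t s' \<Longrightarrow> exec (If r c d) s (t + 1) s'"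
| WhileFalse: "fst s r = 0 \<Longrightarrow> exec (While r c) s 1 s"
| WhileTrue: "fst s r \<noteq> 0 \<Longrightarrow> exec c s t s' \<Longrightarrow> exec (While r c) s' u s''
    \<Longrightarrow> exec (While r c) s (1 + t + u) s''"

inductive_cases exec_elims:
  "exec Skip s t s'" "exec (Const r c) s t s'" "exec (Move r p) s t s'"
  "exec (Add r p q) s t s'" "exec (Sub r p q) s t s'" "exec (Load r p) s t s'"
  "exec (Store p r) s t s'" "exec (Seq c d) s t s'" "exec (If r c d) s t s'"

inductive_cases exec_WhileE: "exec (While r c) s t s'"

lemma exec_deterministic:
  "exec c s t s' \<Longrightarrow> exec c s u s'' \<Longrightarrow> u = t \<and> s'' = s'"
proof (induction arbitrary: u s'' rule: exec.induct)
  case (Seq c s t s1 d t' s2)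
  from Seq.prems obtain x y z where "exec c s x z" "exec d z y s''" "u = x + y"
    by (rule exec_elims(8))
  with Seq.IH show ?case by blast
next
  case (IfTrue s r c t s' d)
  from IfTrue.prems IfTrue.hyps obtain x where "exec c s x s''" "u = x + 1"
    by (auto elim: exec_elims(9))
  with IfTrue.IH show ?case by blast
next
  case (IfFalse s r d t s' c)
  from IfFalse.prems IfFalse.hyps obtain x where "exec d s x s''" "u = x + 1"
    by (auto elim: exec_elims(9))
  with IfFalse.IH show ?case by blast
next
  case (WhileFalse s r c)
  from WhileFalse.prems WhileFalse.hyps show ?case
    by (auto elim: exec_WhileE)
next
  case (WhileTrue s r c t s1 t' s2)
  from WhileTrue.prems WhileTrue.hyps obtain x y z
    where "exec c s x z" "exec (While r c) z y s''" "u = 1 + x + y"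
    by (auto elim: exec_WhileE)
  with WhileTrue.IH show ?case by blast
qed (auto elim: exec_elims)


section \<open>Input and output conventions\<close>

text \<open>A set of hyperedges is presented as a list, in any order and without repetition, of its
  hyperedges, each being a list, in any order and without repetition, of its vertices.\<close>

definition lists_hyperedges :: "nat list list \<Rightarrow> nat set set \<Rightarrow> bool" where
  "lists_hyperedges es E \<longleftrightarrow>
     set ` set es = E \<and> distinct (map set es) \<and> (\<forall>e\<in>set es. distinct e)"

text \<open>The vertex set is \<open>{..<n}\<close>. The memory holds the four sizes, then the vertices of
  the hyperedges of the matching, then those of all hyperedges; everything else is zero.\<close>

definition input_list :: "nat \<Rightarrow> nat \<Rightarrow> nat list list \<Rightarrow> nat list list \<Rightarrow> nat list" where
  "input_list n k es ms = [n, k, length ms, length es] @ concat ms @ concat es"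

definition initial_state :: "nat list \<Rightarrow> state" where
  "initial_state xs = (\<lambda>_. 0, \<lambda>a. if a < length xs then xs ! a else 0)"

text \<open>On halting, register 0 holds the number of bicolorings and register 1 the address of
  a table that contains, one row per bicoloring, the colors of the vertices \<open>0, \<dots>, n - 1\<close>.\<close>

definition output_bicolorings :: "nat \<Rightarrow> state \<Rightarrow> (nat \<Rightarrow> nat) list" where
  "output_bicolorings n s =
     map (\<lambda>j. \<lambda>v\<in>{..<n}. snd s (fst s 1 + j * n + v)) [0..<fst s 0]"

end

theory Submission
  imports Defs
begin

text \<open>Number the matching edges \<open>1, \<dots>, m\<close>, label their vertices accordingly and all other vertices
  with 0. These labels have \<open>L = \<lfloor>log 2 m\<rfloor> + 1\<close> bits, and the \<open>L\<close> bicolorings by the bits of the label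
  take care of every hyperedge on which the label is not constant. By maximality and uniformity the
  remaining hyperedges are exactly the matching edges; one more bicoloring splits all of them.\<close>

section \<open>Covers from separating labels\<close>

text \<open>The time bound does not involve \<open>|E|\<close>, so the program cannot afford to read
  the hyperedges: of \<open>E\<close> it uses only the number, to locate free memory behind the
  input. The matching can be scanned because its edges are disjoint, whence
  \<open>k * m \<le> n\<close>. Label 0 shares the binary range with the \<open>m\<close> edge
  numbers, so \<open>m < 2 ^ L\<close> is all that is asked of \<open>L\<close>; the least such
  \<open>L\<close> is at most \<open>log 2 m + 1\<close>, and the splitting bicoloring supplies the
  other 1 of the bound. Since the machine only adds and subtracts, products become loops of
  additions, comparisons become truncated subtractions, and labels are shifted left by doubling. One
  covering criterion serves both the existence statement over an arbitrary type and the program over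
  \<open>{..<n}\<close>.\<close>

lemma maximal_matching_nonempty:
  assumes "maximal_matching E M" "E \<noteq> {}"
  shows "M \<noteq> {}"
  using assms unfolding maximal_matching_def matching_def by auto

text \<open>An edge outside \<open>M\<close> that avoided \<open>\<Union>M\<close> could be added to
  \<open>M\<close>; an edge of \<open>M\<close> meets itself as soon as it is nonempty.\<close>

lemma maximal_matching_meets:
  assumes "maximal_matching E M" "e \<in> E" "e \<noteq> {}"
  shows "e \<inter> \<Union>M \<noteq> {}"
proof (cases "e \<in> M")
  case True
  with assms(3) show ?thesis by blast
next
  case False
  then have "\<not> matching E (insert e M)" and "matching E M"
    using assms by (auto simp: maximal_matching_def)
  with assms(2) have "\<exists>f\<in>M. \<not> disjnt e f"
    by (auto simp: matching_def pairwise_insert disjnt_sym)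
  then show ?thesis by (auto simp: disjnt_def)
qed

lemma uniform_hypergraph_finite:
  assumes "uniform_hypergraph k V E" "M \<subseteq> E"
  shows "finite M"
proof -
  have "M \<subseteq> Pow V" "finite V" using assms by (auto simp: uniform_hypergraph_def)
  then show ?thesis using finite_subset by blast
qed

text \<open>By maximality an edge with constant label meets the matching, so its label is nonzero and it
  lies inside a matching edge; having the same size, it is that matching edge.\<close>

lemma bicoloring_cover_if_separating:
  fixes lab :: "'a \<Rightarrow> nat"
  assumes G: "uniform_hypergraph k V E" "2 \<le> k" and M: "maximal_matching E M"
    and outside: "\<And>v. v \<in> V \<Longrightarrow> lab v = 0 \<Longrightarrow> v \<notin> \<Union>M"
    and inside: "\<And>u v f. f \<in> M \<Longrightarrow> u \<in> f \<Longrightarrow> v \<in> V \<Longrightarrow> lab v = lab u \<Longrightarrow> v \<in> f"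
    and \<X>: "\<X> \<subseteq> bicolorings V"
    and separating: "\<And>u v. u \<in> V \<Longrightarrow> v \<in> V \<Longrightarrow> lab u \<noteq> lab v \<Longrightarrow> \<exists>X\<in>\<X>. X u \<noteq> X v"
    and splitting: "\<And>f. f \<in> M \<Longrightarrow> \<exists>X\<in>\<X>. \<not> monochromatic X f"
  shows "bicoloring_cover V E \<X>"
  unfolding bicoloring_cover_def
proof (intro conjI ballI \<X>)
  fix e assume e: "e \<in> E"
  have eV: "e \<subseteq> V" "card e = k" "finite V"
    using G e by (auto simp: uniform_hypergraph_def)
  show "\<exists>X\<in>\<X>. \<not> monochromatic X e"
  proof (cases "\<exists>u\<in>e. \<exists>v\<in>e. lab u \<noteq> lab v")
    case True
    then obtain u v where "u \<in> e" "v \<in> e" "lab u \<noteq> lab v" by blast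
    moreover from this obtain X where "X \<in> \<X>" "X u \<noteq> X v" using separating eV by blast
    ultimately show ?thesis unfolding monochromatic_def by metis
  next
    case False
    have "e \<noteq> {}" using eV G(2) by auto
    then obtain u f where u: "u \<in> e" "u \<in> f" "f \<in> M"
      using maximal_matching_meets[OF M e] by blast
    have "e \<subseteq> f" using False u eV(1) inside[of f u] by blast
    moreover have "card f = k" "f \<subseteq> V"
      using G M u by (auto simp: uniform_hypergraph_def maximal_matching_def matching_def)
    ultimately have "e = f" using eV by (metis card_subset_eq finite_subset)
    with splitting u show ?thesis by simp
  qed
qed

section \<open>Binary length and existence of a small cover\<close>

lemma ex_bit_neq:
  fixes x y :: nat
  assumes "x < 2 ^ L" "y < 2 ^ L" "x \<noteq> y"
  shows "\<exists>j<L. bit x j \<noteq> bit y j"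
proof (rule ccontr)
  assume "\<not> ?thesis"
  then have "take_bit L x = take_bit L y" by (auto simp: bit_eq_iff bit_take_bit_iff)
  with assms show False by (simp add: take_bit_nat_eq_self)
qed

text \<open>The first two facts have the form in which the doubling loop uses them: its test
  succeeds for every \<open>j < L\<close> and fails at \<open>L\<close>. The logarithmic bound comes
  from \<open>2 ^ (L - 1) \<le> m\<close>.\<close>

lemma obtain_binary_length:
  fixes m :: nat
  assumes "m \<noteq> 0"
  obtains L where "\<And>j. j < L \<Longrightarrow> 2 ^ j \<le> m" "m < 2 ^ L" "0 < L" "real L \<le> log 2 (real m) + 1"
proof -
  define L where "L = (LEAST l. m < 2 ^ l)"
  have least: "2 ^ j \<le> m" if "j < L" for j
    using not_less_Least[of j "\<lambda>l. m < 2 ^ l"] that by (simp add: L_def)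
  have L: "m < 2 ^ L" unfolding L_def by (rule LeastI[of _ m]) simp
  then have "0 < L" using assms by (cases L) auto
  then have "real (2 ^ (L - 1)) \<le> real m" using least[of "L - 1"] by (simp only: of_nat_le_iff)
  then have "real (L - 1) \<le> log 2 (real m)" using assms by (simp add: le_log_of_power)
  then show ?thesis using that[of L] least L \<open>0 < L\<close> by simp
qed

lemma bicoloring_cover_exists:
  assumes G: "uniform_hypergraph k V E" "2 \<le> k" and M: "maximal_matching E M" and "M \<noteq> {}"
  obtains \<X> where "finite \<X>" "bicoloring_cover V E \<X>"
    "real (card \<X>) \<le> log 2 (real (card M)) + 2"
proof -
  have ME: "M \<subseteq> E" "pairwise disjnt M" using M by (auto simp: maximal_matching_def matching_def)
  have MV: "\<Union>M \<subseteq> V" "\<And>f. f \<in> M \<Longrightarrow> card f = k"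
    using G ME by (auto simp: uniform_hypergraph_def)
  have finM: "finite M" using uniform_hypergraph_finite[OF G(1) ME(1)] .
  then obtain idx where idx: "bij_betw idx M {0..<card M}"
    using ex_bij_betw_finite_nat by blast
  obtain L where L: "card M < 2 ^ L" "real L \<le> log 2 (real (card M)) + 1"
    using obtain_binary_length[of "card M"] finM \<open>M \<noteq> {}\<close> by auto
  define edge where "edge v = (THE f. f \<in> M \<and> v \<in> f)" for v
  have edge: "edge v = f" if "f \<in> M" "v \<in> f" for f v
    unfolding edge_def using that ME(2) by (intro the_equality) (auto simp: pairwise_def disjnt_def)
  define lab where "lab v = (if v \<in> \<Union>M then idx (edge v) + 1 else 0)" for v
  have lab_edge: "lab v = idx f + 1" if "f \<in> M" "v \<in> f" for f v
    using edge[OF that] that by (auto simp: lab_def)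
  have lab_less: "lab v < 2 ^ L" for v
  proof (cases "v \<in> \<Union>M")
    case True
    then obtain f where f: "f \<in> M" "v \<in> f" by blast
    then have "idx f < card M" using idx by (auto dest: bij_betwE)
    then show ?thesis using lab_edge[OF f] L by simp
  qed (simp add: lab_def)
  define bitcol where "bitcol j = (\<lambda>v\<in>V. of_bool (bit (lab v) j) :: nat)" for j
  \<comment> \<open>One chosen vertex of each matching edge gets color 1; as
    \<open>k \<ge> 2\<close>, another one is left with color 0.\<close>
  define split where "split = (\<lambda>v\<in>V. of_bool (v = (SOME w. w \<in> edge v)) :: nat)"
  define \<X> where "\<X> = insert split (bitcol ` {..<L})"
  have "bicoloring_cover V E \<X>"
  proof (rule bicoloring_cover_if_separating[OF G M, where lab = lab])
    show "v \<notin> \<Union>M" if "lab v = 0" for v using that by (auto simp: lab_def split: if_splits)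
    show "v \<in> f" if f: "f \<in> M" "u \<in> f" and lab: "lab v = lab u" for u v f
    proof -
      have "v \<in> \<Union>M" using lab lab_edge[OF f] by (auto simp: lab_def split: if_splits)
      then obtain g where g: "g \<in> M" "v \<in> g" by blast
      then have "idx g = idx f" using lab lab_edge[OF f] lab_edge[OF g] by simp
      then have "g = f" using idx f g by (metis bij_betw_inv_into_left)
      with g show ?thesis by simp
    qed
    show "\<X> \<subseteq> bicolorings V"
      by (auto simp: \<X>_def bicolorings_def bitcol_def split_def)
    show "\<exists>X\<in>\<X>. X u \<noteq> X v" if uv: "u \<in> V" "v \<in> V" "lab u \<noteq> lab v" for u v
    proof -
      obtain j where "j < L" "bit (lab u) j \<noteq> bit (lab v) j"
        using ex_bit_neq[OF lab_less lab_less uv(3)] by blast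
      then have "bitcol j \<in> \<X>" "bitcol j u \<noteq> bitcol j v"
        using uv by (auto simp: \<X>_def bitcol_def)
      then show ?thesis by blast
    qed
    show "\<exists>X\<in>\<X>. \<not> monochromatic X f" if f: "f \<in> M" for f
    proof -
      have card: "card f = k" using MV f by blast
      define w where "w = (SOME w. w \<in> f)"
      have w: "w \<in> f" unfolding w_def using card G(2) by (intro some_in_eq[THEN iffD2]) auto
      have "f \<noteq> {w}" using card G(2) by auto
      then obtain w' where w': "w' \<in> f" "w' \<noteq> w" using w by blast
      have "split w = 1" "split w' = 0"
        using w w' f MV(1) edge[OF f w] edge[OF f w'(1)] by (auto simp: split_def w_def)
      then have "\<not> monochromatic split f" using w w' by (force simp: monochromatic_def)
      then show ?thesis by (auto simp: \<X>_def)
    qed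
  qed
  moreover have "card \<X> \<le> L + 1"
    unfolding \<X>_def using card_image_le[of "{..<L}" bitcol]
    by (intro order.trans[OF card_insert_le_m1]) auto
  then have "real (card \<X>) \<le> log 2 (real (card M)) + 2" using L(2) by linarith
  moreover have "finite \<X>" by (simp add: \<X>_def)
  ultimately show ?thesis using that by blast
qed


section \<open>Timed Hoare triples\<close>

text \<open>Total correctness with an upper bound on the time, so that branches of unequal cost can
  be combined. Asking for some run is enough, because \<open>exec\<close> is deterministic.\<close>

definition triple :: "(state \<Rightarrow> bool) \<Rightarrow> prog \<Rightarrow> nat \<Rightarrow> (state \<Rightarrow> bool) \<Rightarrow> bool" where
  "triple P c T Q \<longleftrightarrow> (\<forall>s. P s \<longrightarrow> (\<exists>t s'. exec c s t s' \<and> t \<le> T \<and> Q s'))"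

lemma triple_Seq:
  assumes "triple P c T Q" "triple Q d U S"
  shows "triple P (Seq c d) (T + U) S"
  unfolding triple_def
proof (intro allI impI)
  fix s assume "P s"
  then obtain t s' where 1: "exec c s t s'" "t \<le> T" "Q s'" using assms(1) unfolding triple_def by blast
  then obtain u s'' where "exec d s' u s''" "u \<le> U" "S s''" using assms(2) unfolding triple_def by blast
  with 1 show "\<exists>t s'. exec (Seq c d) s t s' \<and> t \<le> T + U \<and> S s'"
    by (meson add_mono exec.Seq)
qed

lemma triple_weaken:
  "triple P c T Q \<Longrightarrow> T \<le> U \<Longrightarrow> triple P c U Q"
  unfolding triple_def by (meson order.trans)

text \<open>All loops here have a round count \<open>N\<close> known in advance, so the invariant is
  indexed by the completed rounds. Each round pays its body and one test; the final 1 is the failing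
  test.\<close>

lemma triple_While:
  assumes nonzero: "\<And>i s. i < N \<Longrightarrow> I i s \<Longrightarrow> fst s r \<noteq> 0"
    and zero: "\<And>s. I N s \<Longrightarrow> fst s r = 0"
    and body: "\<And>i. i < N \<Longrightarrow> triple (I i) c T (I (Suc i))"
  shows "triple (I 0) (While r c) (N * (T + 1) + 1) (I N)"
proof -
  \<comment> \<open>\<open>WhileTrue\<close> peels off the first round, hence the induction on the
    number \<open>d\<close> of rounds still to come.\<close>
  have "triple (I (N - d)) (While r c) (d * (T + 1) + 1) (I N)" if "d \<le> N" for d
    using that
  proof (induction d)
    case 0
    show ?case unfolding triple_def
    proof (intro allI impI)
      fix s assume "I (N - 0) s"
      then have "exec (While r c) s 1 s \<and> 1 \<le> 0 * (T + 1) + 1 \<and> I N s"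
        using exec.WhileFalse[OF zero] by simp
      then show "\<exists>t s'. exec (While r c) s t s' \<and> t \<le> 0 * (T + 1) + 1 \<and> I N s'" by blast
    qed
  next
    case (Suc d)
    show ?case unfolding triple_def
    proof (intro allI impI)
      fix s assume s: "I (N - Suc d) s"
      have N: "N - Suc d < N" "Suc (N - Suc d) = N - d" using Suc.prems by auto
      then obtain t s' where 1: "exec c s t s'" "t \<le> T" "I (N - d) s'"
        using body[OF N(1)] s unfolding triple_def N(2) by blast
      then obtain u s'' where 2: "exec (While r c) s' u s''" "u \<le> d * (T + 1) + 1" "I N s''"
        using Suc.IH[OF Suc_leD[OF Suc.prems]] unfolding triple_def by blast
      have "exec (While r c) s (1 + t + u) s''"
        using exec.WhileTrue[OF nonzero[OF N(1) s] 1(1) 2(1)] .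
      moreover have "1 + t + u \<le> Suc d * (T + 1) + 1" using 1(2) 2(2) by simp
      ultimately show "\<exists>t s'. exec (While r c) s t s' \<and> t \<le> Suc d * (T + 1) + 1 \<and> I N s'"
        using 2(3) by blast
    qed
  qed
  from this[of N] show ?thesis by simp
qed

section \<open>Symbolic execution of loop-free code\<close>

fun loop_free :: "prog \<Rightarrow> bool" where
  "loop_free (Seq c d) \<longleftrightarrow> loop_free c \<and> loop_free d"
| "loop_free (If r c d) \<longleftrightarrow> loop_free c \<and> loop_free d"
| "loop_free (While r c) \<longleftrightarrow> False"
| "loop_free _ \<longleftrightarrow> True"

text \<open>Without loops the semantics is a total function that the simplifier can evaluate. The
  value on \<open>While\<close> is a dummy, excluded by \<open>loop_free\<close> wherever
  \<open>run\<close> is tied to \<open>exec\<close>.\<close>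

fun run :: "prog \<Rightarrow> state \<Rightarrow> state" where
  "run (Const r c) (R, A) = (R(r := c), A)"
| "run (Move r p) (R, A) = (R(r := R p), A)"
| "run (Add r p q) (R, A) = (R(r := R p + R q), A)"
| "run (Sub r p q) (R, A) = (R(r := R p - R q), A)"
| "run (Load r p) (R, A) = (R(r := A (R p)), A)"
| "run (Store p r) (R, A) = (R, A(R p := R r))"
| "run (Seq c d) s = run d (run c s)"
| "run (If r c d) s = (if fst s r \<noteq> 0 then run c s else run d s)"
| "run _ s = s"

fun cost :: "prog \<Rightarrow> nat" where
  "cost (Seq c d) = cost c + cost d"
| "cost (If r c d) = max (cost c) (cost d) + 1"
| "cost _ = 1"

lemma exec_run: "loop_free c \<Longrightarrow> \<exists>t. exec c s t (run c s) \<and> t \<le> cost c"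
proof (induction c arbitrary: s)
  case (Seq c d)
  then obtain t u where "exec c s t (run c s)" "t \<le> cost c"
    "exec d (run c s) u (run d (run c s))" "u \<le> cost d"
    by (meson loop_free.simps(1))
  then have "exec (Seq c d) s (t + u) (run (Seq c d) s)" "t + u \<le> cost (Seq c d)"
    using exec.Seq by simp_all
  then show ?case by blast
next
  case (If r c d)
  show ?case
  proof (cases "fst s r = 0")
    case True
    from If obtain t where "exec d s t (run d s)" "t \<le> cost d" by (meson loop_free.simps(2))
    then have "exec (If r c d) s (t + 1) (run (If r c d) s)" "t + 1 \<le> cost (If r c d)"
      using exec.IfFalse[OF True] True by simp_all
    then show ?thesis by blast
  next
    case False
    from If obtain t where "exec c s t (run c s)" "t \<le> cost c" by (meson loop_free.simps(2))
    then have "exec (If r c d) s (t + 1) (run (If r c d) s)" "t + 1 \<le> cost (If r c d)"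
      using exec.IfTrue[OF False] False by simp_all
    then show ?thesis by blast
  qed
qed (cases s; fastforce intro: exec.intros)+

lemma triple_run:
  assumes "loop_free c" "\<And>R A. P (R, A) \<Longrightarrow> Q (run c (R, A))"
  shows "triple P c (cost c) Q"
  unfolding triple_def using exec_run[OF assms(1)] assms(2) by (metis prod.collapse)

fun block :: "prog list \<Rightarrow> prog" where
  "block [] = Skip"
| "block (c # cs) = Seq c (block cs)"


section \<open>The program\<close>

text \<open>Registers: 1 the table \<open>B\<close>, 2 to 5 the four sizes \<open>n\<close>, \<open>k\<close>, \<open>m\<close>, \<open>|E|\<close>, 6 the constant 1,
  7 the power \<open>2 ^ L\<close>, 8 and 9 the loop counters \<open>L * n\<close> and \<open>k * m\<close>. Doubling stops at the least
  \<open>L\<close> with \<open>m < 2 ^ L\<close>.\<close>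

definition read_sizes :: prog where
  "read_sizes = block [Const 6 1, Const 10 0, Load 2 10, Load 3 6, Const 10 2, Load 4 10,
     Const 10 3, Load 5 10, Const 1 4, Move 10 3]"

text \<open>Forms \<open>k * (m + |E|)\<close> and \<open>k * m\<close> by repeated addition. Taking
  \<open>k\<close> rounds, rather than \<open>|E|\<close>, keeps this within the time bound, as
  \<open>k \<le> n\<close>.\<close>

definition address_body :: prog where
  "address_body = block [Add 1 1 4, Add 1 1 5, Add 9 9 4, Sub 10 10 6]"

definition doubling_init :: prog where
  "doubling_init = block [Const 7 1, Const 0 1, Move 10 4]"

text \<open>Register 10 becomes the truncated difference \<open>m + 1 - 2 ^ L\<close>, nonzero
  exactly while \<open>2 ^ L \<le> m\<close>. Register 0 starts at 1 to count row 0.\<close>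

definition doubling_body :: prog where
  "doubling_body = block [Add 7 7 7, Add 0 0 6, Add 8 8 2, Add 10 4 6, Sub 10 10 7]"

text \<open>Row 0 marks the last vertex of every matching edge, and row 1 receives the labels: \<open>i + 1\<close>
  on the matching edge number \<open>i\<close>, counted from 0, and 0 outside the matching. Register 12 counts down the rest of the
  current edge and register 13 is its label.\<close>

definition scan_init :: prog where
  "scan_init = block [Const 11 4, Move 12 3, Const 13 1, Add 16 1 2]"

definition scan_body :: prog where
  "scan_body = block [Load 14 11, Add 15 16 14, Store 15 13, Sub 12 12 6,
     If 12 Skip (block [Add 15 1 14, Store 15 6, Move 12 3, Add 13 13 6]),
     Add 11 11 6, Sub 9 9 6]"

text \<open>The bits of the labels are extracted from the top, since there is no cheap way to halve: each
  entry \<open>x\<close> is replaced by the leading bit of \<open>2 * x\<close>, and \<open>2 * x mod 2 ^ L\<close> is passed to the same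
  vertex in the next row, \<open>n\<close> cells further.\<close>

definition bits_init :: prog where
  "bits_init = Sub 17 7 6"

text \<open>Register 17 is \<open>2 ^ L - 1\<close>, so the truncated
  \<open>2 * x - (2 ^ L - 1)\<close> is nonzero exactly when \<open>2 ^ L \<le> 2 * x\<close>. The
  last row passes its remainders to an extra row below the output.\<close>

definition bits_body :: prog where
  "bits_body = block [Load 14 16, Add 14 14 14, Sub 15 14 17,
     If 15 (block [Const 15 1, Sub 14 14 7]) Skip,
     Store 16 15, Add 10 16 2, Store 10 14, Add 16 16 6, Sub 8 8 6]"

definition cover_program :: prog where
  "cover_program =
     Seq read_sizes (Seq (While 10 address_body)
    (Seq doubling_init (Seq (While 10 doubling_body)
    (Seq scan_init (Seq (While 9 scan_body)
    (Seq bits_init (While 8 bits_body)))))))"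

section \<open>Loop invariants and their preservation\<close>

definition address_inv :: "nat \<Rightarrow> nat \<Rightarrow> nat \<Rightarrow> nat \<Rightarrow> (nat \<Rightarrow> nat) \<Rightarrow> nat \<Rightarrow> state \<Rightarrow> bool" where
  "address_inv n k m e A0 s = (\<lambda>(R, A). A = A0 \<and> R 1 = 4 + s * (m + e) \<and> R 2 = n \<and> R 3 = k
     \<and> R 4 = m \<and> R 5 = e \<and> R 6 = 1 \<and> R 8 = 0 \<and> R 9 = s * m \<and> R 10 = k - s)"

definition doubling_inv ::
    "nat \<Rightarrow> nat \<Rightarrow> nat \<Rightarrow> nat \<Rightarrow> (nat \<Rightarrow> nat) \<Rightarrow> nat \<Rightarrow> state \<Rightarrow> bool" where
  "doubling_inv n k m B A0 s = (\<lambda>(R, A). A = A0 \<and> R 0 = s + 1 \<and> R 1 = B \<and> R 2 = n \<and> R 3 = k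
     \<and> R 4 = m \<and> R 6 = 1 \<and> R 7 = 2 ^ s \<and> R 8 = s * n \<and> R 9 = k * m \<and> R 10 = m + 1 - 2 ^ s)"

text \<open>\<open>lab\<close> and \<open>spl\<close> are the intended final rows; vertices not yet
  scanned still show the zeros of the initial memory.\<close>

definition scan_inv ::
    "nat \<Rightarrow> nat \<Rightarrow> nat \<Rightarrow> nat \<Rightarrow> nat list \<Rightarrow> (nat \<Rightarrow> nat) \<Rightarrow> (nat \<Rightarrow> nat) \<Rightarrow> nat \<Rightarrow> state \<Rightarrow> bool" where
  "scan_inv n k L B xs lab spl s = (\<lambda>(R, A). R 0 = L + 1 \<and> R 1 = B \<and> R 2 = n \<and> R 3 = k
     \<and> R 6 = 1 \<and> R 7 = 2 ^ L \<and> R 8 = L * n \<and> R 9 = length xs - s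
     \<and> R 11 = 4 + s \<and> R 12 = k - s mod k \<and> R 13 = s div k + 1 \<and> R 16 = B + n
     \<and> (\<forall>i<length xs. A (4 + i) = xs ! i)
     \<and> (\<forall>v<n. A (B + v) = (if v \<in> set (take s xs) then spl v else 0))
     \<and> (\<forall>v<n. A (B + n + v) = (if v \<in> set (take s xs) then lab v else 0)))"

text \<open>Cell \<open>i\<close> of the rows from row 1 on belongs to vertex
  \<open>i mod n\<close>; its label has lost its top \<open>i div n\<close> bits and is aligned left
  within \<open>L\<close> bits.\<close>

definition shifted :: "nat \<Rightarrow> nat \<Rightarrow> (nat \<Rightarrow> nat) \<Rightarrow> nat \<Rightarrow> nat" where
  "shifted n L lab i = (2 ^ (i div n) * lab (i mod n)) mod 2 ^ L"

text \<open>The first \<open>s\<close> cells are final colors; the next \<open>n\<close> form a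
  sliding window of pending shifted labels, one per vertex.\<close>

definition bits_inv ::
    "nat \<Rightarrow> nat \<Rightarrow> nat \<Rightarrow> (nat \<Rightarrow> nat) \<Rightarrow> (nat \<Rightarrow> nat) \<Rightarrow> nat \<Rightarrow> state \<Rightarrow> bool" where
  "bits_inv n L B lab spl s = (\<lambda>(R, A). R 0 = L + 1 \<and> R 1 = B \<and> R 2 = n \<and> R 6 = 1
     \<and> R 7 = 2 ^ L \<and> R 8 = L * n - s \<and> R 16 = B + n + s \<and> R 17 = 2 ^ L - 1
     \<and> (\<forall>v<n. A (B + v) = spl v)
     \<and> (\<forall>i<s + n. A (B + n + i) =
          (if i < s then of_bool (2 ^ L \<le> 2 * shifted n L lab i) else shifted n L lab i)))"

lemma address_step:
  assumes "i < k"
  shows "triple (address_inv n k m e A i) address_body (cost address_body)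
    (address_inv n k m e A (Suc i))"
  by (rule triple_run) (auto simp: address_body_def address_inv_def)

lemma doubling_step:
  "triple (doubling_inv n k m B A i) doubling_body (cost doubling_body)
    (doubling_inv n k m B A (Suc i))"
  by (rule triple_run) (auto simp: doubling_body_def doubling_inv_def)

lemma scan_step:
  assumes k: "2 \<le> k" and xs: "distinct xs" "set xs \<subseteq> {..<n}" and B: "4 + length xs \<le> B"
    and lab: "\<And>i. i < length xs \<Longrightarrow> lab (xs ! i) = i div k + 1"
    and spl: "\<And>i. i < length xs \<Longrightarrow> spl (xs ! i) = of_bool (Suc i mod k = 0)"
    and i: "i < length xs"
  shows "triple (scan_inv n k L B xs lab spl i) scan_body (cost scan_body)
    (scan_inv n k L B xs lab spl (Suc i))"
proof (rule triple_run)
  show "loop_free scan_body" by (simp add: scan_body_def)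
  fix R A assume inv: "scan_inv n k L B xs lab spl i (R, A)"
  define v where "v = xs ! i"
  have v: "v < n" using xs i nth_mem by (fastforce simp: v_def)
  have take: "set (take (Suc i) xs) = insert v (set (take i xs))"
    using i by (simp add: take_Suc_conv_app_nth v_def)
  have fresh: "v \<notin> set (take i xs)"
    using xs(1) i id_take_nth_drop[OF i] by (metis v_def distinct_append disjoint_insert(1) list.set(2))
  have Rv: "A (4 + i) = v" using inv i by (simp add: scan_inv_def v_def)
  have labv: "lab v = Suc (i div k)" and splv: "spl v = of_bool (Suc i mod k = 0)"
    using lab[OF i] spl[OF i] by (simp_all add: v_def)
  have less: "i mod k < k" using k by simp
  show "scan_inv n k L B xs lab spl (Suc i) (run scan_body (R, A))"
  \<comment> \<open>This is the test on register 12 after its decrement: whether position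
    \<open>i\<close> ends a matching edge.\<close>
  proof (cases "Suc (i mod k) = k")
    case True
    then have mod: "Suc i mod k = 0" "Suc i div k = Suc (i div k)" by (auto simp: mod_Suc div_Suc)
    from True have "k - i mod k - 1 = 0" by simp
    then show ?thesis
      using inv v fresh Rv labv splv mod B
      unfolding scan_inv_def scan_body_def
      by (auto simp: take)
  next
    case False
    then have mod: "Suc i mod k = Suc (i mod k)" "Suc i div k = i div k"
      by (auto simp: mod_Suc div_Suc)
    from False less have "k - i mod k - 1 \<noteq> 0" by simp
    then show ?thesis
      using inv v fresh Rv labv splv mod B
      unfolding scan_inv_def scan_body_def
      by (auto simp: take)
  qed
qed

lemma shifted_less: "shifted n L lab i < 2 ^ L"
  by (simp add: shifted_def)

lemma shifted_add:
  assumes "0 < n"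
  shows "shifted n L lab (i + n) = 2 * shifted n L lab i mod 2 ^ L"
  using assms by (simp add: shifted_def mod_mult_right_eq mult.assoc)

lemma double_mod_eq:
  fixes x P :: nat
  assumes "x < P"
  shows "2 * x mod P = (if P \<le> 2 * x then 2 * x - P else 2 * x)"
  using assms by (simp add: le_mod_geq)

lemma bits_step:
  assumes n: "0 < n"
  shows "triple (bits_inv n L B lab spl i) bits_body (cost bits_body)
    (bits_inv n L B lab spl (Suc i))"
proof (rule triple_run)
  show "loop_free bits_body" by (simp add: bits_body_def)
  fix R A assume inv: "bits_inv n L B lab spl i (R, A)"
  define x where "x = shifted n L lab i"
  have x: "A (B + n + i) = x" using inv n by (auto simp: bits_inv_def x_def)
  have next_x: "shifted n L lab (i + n) = (if 2 ^ L \<le> 2 * x then 2 * x - 2 ^ L else 2 * x)"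
    using shifted_add[OF n] double_mod_eq[OF shifted_less] by (simp add: x_def)
  \<comment> \<open>Finished cells, the cell that now becomes a color, the untouched window, and the
    cell entering the window; \<open>0 < n\<close> keeps the second and the last apart.\<close>
  have cases: "j < i \<or> j = i \<or> (i < j \<and> j < i + n) \<or> j = i + n" if "j < Suc i + n" for j
    using that by linarith
  have test: "(x + x - (2 ^ L - 1) \<noteq> 0) = (2 ^ L \<le> 2 * x)"
    by (metis One_nat_def Suc_pred diff_is_0_eq mult_2 not_less_eq_eq pos2 zero_less_power)
  show "bits_inv n L B lab spl (Suc i) (run bits_body (R, A))"
  proof (cases "2 ^ L \<le> 2 * x")
    case True
    then show ?thesis
      using inv n x next_x test unfolding bits_inv_def bits_body_def
      by (auto simp: x_def[symmetric] dest!: cases)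
  next
    case False
    then show ?thesis
      using inv n x next_x test unfolding bits_inv_def bits_body_def
      by (auto simp: x_def[symmetric] dest!: cases)
  qed
qed


section \<open>Assembling the program and its step count\<close>

lemma cover_program_correct:
  assumes k: "2 \<le> k" and n: "0 < n" and m: "0 < m"
    and xs: "distinct xs" "set xs \<subseteq> {..<n}" "length xs = k * m"
    and A: "A 0 = n" "A 1 = k" "A 2 = m" "A 3 = e" "\<And>i. i < length xs \<Longrightarrow> A (4 + i) = xs ! i"
      "\<And>a. 4 + k * (m + e) \<le> a \<Longrightarrow> A a = 0"
    and L: "\<And>j. j < L \<Longrightarrow> 2 ^ j \<le> m" "m < 2 ^ L"
    and lab: "\<And>i. i < length xs \<Longrightarrow> lab (xs ! i) = i div k + 1"
      "\<And>v. v \<notin> set xs \<Longrightarrow> lab v = 0" "\<And>v. lab v < 2 ^ L"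
    and spl: "\<And>i. i < length xs \<Longrightarrow> spl (xs ! i) = of_bool (Suc i mod k = 0)"
      "\<And>v. v \<notin> set xs \<Longrightarrow> spl v = 0"
  shows "triple (\<lambda>s. s = (\<lambda>_. 0, A)) cover_program (25 + 6 * k + 7 * L + 15 * (k * m) + 15 * (L * n))
    (bits_inv n L (4 + k * (m + e)) lab spl (L * n))"
proof -
  define B where "B = 4 + k * (m + e)"
  have k1: "k mod k = 0" "0 < k" using k by auto
  have 1: "triple (\<lambda>s. s = (\<lambda>_. 0, A)) read_sizes (cost read_sizes) (address_inv n k m e A 0)"
    using A by (intro triple_run) (auto simp: read_sizes_def address_inv_def)
  have 2: "triple (address_inv n k m e A 0) (While 10 address_body)
      (k * (cost address_body + 1) + 1) (address_inv n k m e A k)"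
    by (rule triple_While) (simp_all add: address_step, auto simp: address_inv_def)
  have 3: "triple (address_inv n k m e A k) doubling_init (cost doubling_init)
      (doubling_inv n k m B A 0)"
    by (rule triple_run) (auto simp: address_inv_def doubling_inv_def doubling_init_def B_def)
  have 4: "triple (doubling_inv n k m B A 0) (While 10 doubling_body)
      (L * (cost doubling_body + 1) + 1) (doubling_inv n k m B A L)"
  proof (rule triple_While)
    show "fst s 10 \<noteq> 0" if "i < L" "doubling_inv n k m B A i s" for i s
      using that L(1)[of i] by (auto simp: doubling_inv_def split: prod.splits)
    show "fst s 10 = 0" if "doubling_inv n k m B A L s" for s
      using that L(2) by (auto simp: doubling_inv_def split: prod.splits)
  qed (rule doubling_step)
  have 5: "triple (doubling_inv n k m B A L) scan_init (cost scan_init)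
      (scan_inv n k L B xs lab spl 0)"
    using A xs by (intro triple_run) (auto simp: doubling_inv_def scan_inv_def scan_init_def B_def)
  have 6: "triple (scan_inv n k L B xs lab spl 0) (While 9 scan_body)
      (k * m * (cost scan_body + 1) + 1) (scan_inv n k L B xs lab spl (k * m))"
  proof (rule triple_While)
    show "triple (scan_inv n k L B xs lab spl i) scan_body (cost scan_body)
        (scan_inv n k L B xs lab spl (Suc i))" if "i < k * m" for i
      using that xs lab spl by (intro scan_step k) (auto simp: B_def algebra_simps)
  qed (auto simp: scan_inv_def xs)
  have 7: "triple (scan_inv n k L B xs lab spl (k * m)) bits_init (cost bits_init)
      (bits_inv n L B lab spl 0)"
    using xs lab spl
    by (intro triple_run) (auto simp: scan_inv_def bits_inv_def bits_init_def shifted_def)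
  have 8: "triple (bits_inv n L B lab spl 0) (While 8 bits_body)
      (L * n * (cost bits_body + 1) + 1) (bits_inv n L B lab spl (L * n))"
    by (rule triple_While) (simp_all add: bits_step[OF n], auto simp: bits_inv_def)
  have "triple (\<lambda>s. s = (\<lambda>_. 0, A)) cover_program
     (cost read_sizes + ((k * (cost address_body + 1) + 1) + (cost doubling_init +
       ((L * (cost doubling_body + 1) + 1) + (cost scan_init + ((k * m * (cost scan_body + 1) + 1) +
       (cost bits_init + (L * n * (cost bits_body + 1) + 1))))))))
     (bits_inv n L B lab spl (L * n))"
    unfolding cover_program_def by (intro triple_Seq[OF 1] triple_Seq[OF 2] triple_Seq[OF 3]
        triple_Seq[OF 4] triple_Seq[OF 5] triple_Seq[OF 6] triple_Seq[OF 7] 8)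
  then have "triple (\<lambda>s. s = (\<lambda>_. 0, A)) cover_program (25 + 6 * k + 7 * L + 15 * (k * m) + 15 * (L * n))
     (bits_inv n L B lab spl (L * n))"
    \<comment> \<open>A round, with its test, costs at most 6, 7, 14 and 14 in the four loops, and
      everything else costs 25; the two 14s are rounded up to 15.\<close>
    by (rule triple_weaken) (simp add: read_sizes_def address_body_def doubling_init_def doubling_body_def
        scan_init_def scan_body_def bits_init_def bits_body_def)
  then show ?thesis by (simp add: B_def)
qed

lemma top_bit_iff:
  fixes y :: nat
  assumes "y < 2 ^ Suc q"
  shows "bit y q \<longleftrightarrow> 2 ^ Suc q \<le> 2 * y"
proof -
  have "y div 2 ^ q < 2" using assms by (simp add: less_mult_imp_div_less)
  moreover have "2 ^ q \<le> y \<longleftrightarrow> 1 \<le> y div 2 ^ q"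
    by (simp add: less_eq_div_iff_mult_less_eq)
  ultimately show ?thesis by (auto simp: bit_iff_odd less_2_cases_iff)
qed

text \<open>Doubling \<open>j\<close> times modulo \<open>2 ^ L\<close> brings bit
  \<open>L - 1 - j\<close> to the top position, where comparing the double with \<open>2 ^ L\<close>
  reads it off.\<close>

lemma shifted_top_bit:
  assumes "j < L" "v < n"
  shows "2 ^ L \<le> 2 * shifted n L lab (j * n + v) \<longleftrightarrow> bit (lab v) (L - 1 - j)"
proof -
  obtain q where q: "L = Suc q" using assms by (cases L) auto
  have "shifted n L lab (j * n + v) = take_bit L (push_bit j (lab v))"
    using assms by (simp add: shifted_def take_bit_eq_mod push_bit_eq_mult mult.commute)
  moreover have "bit (take_bit L (push_bit j (lab v))) q \<longleftrightarrow> bit (lab v) (q - j)"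
    using assms q by (auto simp: bit_take_bit_iff bit_push_bit_iff)
  ultimately show ?thesis
    using top_bit_iff[of "shifted n L lab (j * n + v)" q] shifted_less[of n L lab "j * n + v"] q
    by simp
qed


section \<open>Presented hypergraphs\<close>

lemma length_concat_uniform:
  assumes "\<And>x. x \<in> set ls \<Longrightarrow> length x = k"
  shows "length (concat ls) = k * length ls"
  using assms by (induction ls) auto

text \<open>Equal lengths turn the flat list into a matrix: the quotient of a position by
  \<open>k\<close> is the edge number, the remainder the place within the edge.\<close>

lemma nth_concat_uniform:
  assumes "\<And>x. x \<in> set ls \<Longrightarrow> length x = k" "i < length ls" "j < k"
  shows "concat ls ! (i * k + j) = ls ! i ! j"
  using assms
proof (induction ls arbitrary: i)
  case (Cons x ls)
  then show ?case by (cases i) (auto simp: nth_append)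
qed simp

lemma lists_hyperedges_length:
  assumes "uniform_hypergraph k V E" "F \<subseteq> E" "lists_hyperedges es F" "x \<in> set es"
  shows "length x = k"
  using assms distinct_card[of x] by (fastforce simp: uniform_hypergraph_def lists_hyperedges_def)

lemma cover_program_covers:
  assumes G: "uniform_hypergraph k {..<n} E" "2 \<le> k" "E \<noteq> {}" and M: "maximal_matching E M"
    and es: "lists_hyperedges es E" and ms: "lists_hyperedges ms M"
  obtains t s where "exec cover_program (initial_state (input_list n k es ms)) t s"
    "bicoloring_cover {..<n} E (set (output_bicolorings n s))"
    "real (length (output_bicolorings n s)) \<le> log 2 (real (card M)) + 2"
    "real t \<le> 140 * real n * max 1 (log 2 (real (card M)))"
proof -
  define m xs where "m = length ms" and "xs = concat ms"
  have ME: "M \<subseteq> E" "pairwise disjnt M" using M by (auto simp: maximal_matching_def matching_def)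
  have M_eq: "M = set ` set ms" and dist: "distinct (map set ms)" "\<And>x. x \<in> set ms \<Longrightarrow> distinct x"
    using ms by (auto simp: lists_hyperedges_def)
  have m: "m = card M" using dist(1) by (metis M_eq m_def distinct_card length_map set_map)
  have "finite M" using uniform_hypergraph_finite[OF G(1) ME(1)] .
  then have m0: "0 < m" using maximal_matching_nonempty[OF M G(3)] by (simp add: m card_gt_0_iff)
  have len: "length x = k" if "x \<in> set ms" for x
    using lists_hyperedges_length[OF G(1) ME(1) ms that] .
  have len_xs: "length xs = k * m"
    unfolding xs_def m_def by (rule length_concat_uniform) (rule len)
  have len_es: "length (concat es) = k * length es"
    by (rule length_concat_uniform) (rule lists_hyperedges_length[OF G(1) order.refl es])
  have set_xs: "set xs = \<Union>M" by (auto simp: xs_def M_eq)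
  then have xs_n: "set xs \<subseteq> {..<n}" using G(1) ME by (auto simp: uniform_hypergraph_def)
  have dist_xs: "distinct xs"
    unfolding xs_def
  proof (rule distinct_concat)
    show "distinct ms" using dist(1) by (simp add: distinct_map)
    show "set x \<inter> set y = {}" if "x \<in> set ms" "y \<in> set ms" "x \<noteq> y" for x y
    proof -
      have "set x \<noteq> set y" using dist(1) that by (auto simp: distinct_map dest: inj_onD)
      then show ?thesis using that ME(2) by (auto simp: M_eq pairwise_def disjnt_def)
    qed
  qed (rule dist)
  \<comment> \<open>Disjoint matching edges have \<open>k * m\<close> vertices in total; this makes
    the scan linear in \<open>n\<close>.\<close>
  have km: "k * m \<le> n"
    using card_mono[OF _ xs_n] distinct_card[OF dist_xs] len_xs by simp
  moreover have "k * 1 \<le> k * m" using m0 by (intro mult_le_mono2) simp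
  ultimately have "k \<le> n" by linarith
  then have n0: "0 < n" using G(2) by simp
  obtain L where L: "\<And>j. j < L \<Longrightarrow> 2 ^ j \<le> m" "m < 2 ^ L" "0 < L" "real L \<le> log 2 (real m) + 1"
    using obtain_binary_length[of m] m0 by auto
  define pos where "pos v = inv_into {..<length xs} (nth xs) v" for v
  have pos: "pos (xs ! i) = i" if "i < length xs" for i
    unfolding pos_def using that dist_xs by (intro inv_into_f_f inj_on_nth) auto
  define lab where "lab v = (if v \<in> set xs then pos v div k + 1 else 0)" for v
  define spl :: "nat \<Rightarrow> nat" where "spl v = of_bool (v \<in> set xs \<and> Suc (pos v) mod k = 0)" for v
  have idx: "i * k + j < length xs" "xs ! (i * k + j) = ms ! i ! j" if "i < m" "j < k" for i j
  proof -
    have "Suc i * k \<le> m * k" using that by (intro mult_le_mono1) simp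
    then show "i * k + j < length xs" using that by (simp add: len_xs mult.commute)
    show "xs ! (i * k + j) = ms ! i ! j"
      unfolding xs_def using that len by (intro nth_concat_uniform) (auto simp: m_def)
  qed
  have lab_edge: "lab v = i + 1" if iv: "i < m" "v \<in> set (ms ! i)" for i v
  proof -
    have "length (ms ! i) = k" using len that by (simp add: m_def)
    then obtain j where j: "j < k" "v = ms ! i ! j" using iv(2) by (auto simp: in_set_conv_nth)
    note ij = idx[OF iv(1) j(1)]
    have "pos v = i * k + j" "v \<in> set xs"
      using pos[OF ij(1)] nth_mem[OF ij(1)] by (simp_all only: ij(2) j(2))
    then show ?thesis using j(1) by (simp add: lab_def)
  qed
  have obtain_edge: "\<exists>i<m. v \<in> set (ms ! i)" if "v \<in> set xs" for v
  proof -
    obtain x where "x \<in> set ms" "v \<in> set x" using \<open>v \<in> set xs\<close> by (auto simp: xs_def)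
    then show ?thesis by (metis in_set_conv_nth m_def)
  qed
  have lab_less: "lab v < 2 ^ L" for v
  proof (cases "v \<in> set xs")
    case True
    then obtain i where "i < m" "v \<in> set (ms ! i)" using obtain_edge by blast
    then show ?thesis using lab_edge L(2) by simp
  qed (simp add: lab_def)
  define A where "A = snd (initial_state (input_list n k es ms))"
  define e B where "e = length es" and "B = 4 + k * (m + e)"
  have "triple (\<lambda>s. s = (\<lambda>_. 0, A)) cover_program (25 + 6 * k + 7 * L + 15 * (k * m) + 15 * (L * n))
    (bits_inv n L (4 + k * (m + e)) lab spl (L * n))"
  proof (rule cover_program_correct[OF G(2) n0 m0 dist_xs xs_n len_xs])
    show "A 0 = n" "A 1 = k" "A 2 = m" "A 3 = e"
      by (auto simp: A_def initial_state_def input_list_def m_def e_def)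
    show "A (4 + i) = xs ! i" if "i < length xs" for i
      using that by (simp add: A_def initial_state_def input_list_def xs_def nth_append)
    show "A a = 0" if "4 + k * (m + e) \<le> a" for a
      using that len_xs len_es
      by (simp add: A_def initial_state_def input_list_def xs_def e_def algebra_simps)
  qed (use L lab_less pos in \<open>auto simp: lab_def spl_def\<close>)
  moreover have "initial_state (input_list n k es ms) = (\<lambda>_. 0, A)"
    by (simp add: A_def initial_state_def)
  ultimately obtain t R A' where
    ex: "exec cover_program (initial_state (input_list n k es ms)) t (R, A')"
    and t: "t \<le> 25 + 6 * k + 7 * L + 15 * (k * m) + 15 * (L * n)"
    and inv: "bits_inv n L B lab spl (L * n) (R, A')"
    unfolding triple_def B_def by (metis prod.collapse)
  define row where "row j = (\<lambda>v\<in>{..<n}. A' (B + j * n + v))" for j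
  have out: "output_bicolorings n (R, A') = map row [0..<L + 1]"
    using inv by (auto simp: output_bicolorings_def row_def bits_inv_def)
  have row_0: "row 0 v = spl v" if "v < n" for v
    using inv that by (auto simp: row_def bits_inv_def)
  have row_Suc: "row (Suc j) v = of_bool (bit (lab v) (L - 1 - j))" if "j < L" "v < n" for j v
  proof -
    \<comment> \<open>The cell thus lies in the part that the final invariant describes as
      colors.\<close>
    have "j * n + v < L * n"
      using that mult_le_mono1[of "Suc j" L n] by simp
    then have "A' (B + n + (j * n + v)) = of_bool (2 ^ L \<le> 2 * shifted n L lab (j * n + v))"
      using inv by (simp add: bits_inv_def)
    then show ?thesis using that shifted_top_bit[OF that] by (simp add: row_def algebra_simps)
  qed
  have "bicoloring_cover {..<n} E (set (output_bicolorings n (R, A')))"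
  proof (rule bicoloring_cover_if_separating[OF G(1,2) M, where lab = lab])
    show "v \<notin> \<Union>M" if "lab v = 0" for v
      using that by (auto simp: lab_def set_xs split: if_splits)
    show "v \<in> f" if f: "f \<in> M" "u \<in> f" and lab: "lab v = lab u" for u v f
    proof -
      obtain i where i: "i < m" "f = set (ms ! i)" using f by (auto simp: M_eq m_def in_set_conv_nth)
      then have "lab v = i + 1" using lab lab_edge f by simp
      moreover from this obtain i' where "i' < m" "v \<in> set (ms ! i')"
        using obtain_edge by (fastforce simp: lab_def split: if_splits)
      ultimately show ?thesis using lab_edge i by fastforce
    qed
    have "row j \<in> bicolorings {..<n}" if "j < L + 1" for j
      using that row_0 row_Suc unfolding bicolorings_def
      by (cases j) (auto simp: PiE_iff spl_def, auto simp: row_def)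
    then show "set (output_bicolorings n (R, A')) \<subseteq> bicolorings {..<n}" by (auto simp: out)
    show "\<exists>X\<in>set (output_bicolorings n (R, A')). X u \<noteq> X v"
      if uv: "u \<in> {..<n}" "v \<in> {..<n}" "lab u \<noteq> lab v" for u v
    proof -
      obtain j where j: "j < L" "bit (lab u) j \<noteq> bit (lab v) j"
        using ex_bit_neq[OF lab_less lab_less uv(3)] by blast
      \<comment> \<open>Bits come out from the top, so bit \<open>j\<close> stands in the reversed
        row, shifted by one because row 0 is the splitting bicoloring.\<close>
      then have "row (Suc (L - 1 - j)) u \<noteq> row (Suc (L - 1 - j)) v"
        using uv row_Suc[of "L - 1 - j"] by simp
      moreover have "row (Suc (L - 1 - j)) \<in> set (output_bicolorings n (R, A'))"
        unfolding out set_map set_upt using j by (intro imageI) auto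
      ultimately show ?thesis by blast
    qed
    show "\<exists>X\<in>set (output_bicolorings n (R, A')). \<not> monochromatic X f" if f: "f \<in> M" for f
    proof -
      obtain i where i: "i < m" "f = set (ms ! i)" using f by (auto simp: M_eq m_def in_set_conv_nth)
      have row: "row 0 (ms ! i ! j) = of_bool (Suc j mod k = 0)" "ms ! i ! j \<in> f" if j: "j < k" for j
      proof -
        show f': "ms ! i ! j \<in> f" using i len j by (simp add: m_def)
        then have "ms ! i ! j < n" "ms ! i ! j \<in> set xs" using f set_xs xs_n by auto
        moreover have "Suc (i * k + j) mod k = Suc j mod k" by (metis add_Suc_right mod_mult_self3)
        ultimately show "row 0 (ms ! i ! j) = of_bool (Suc j mod k = 0)"
          using row_0 pos[OF idx(1)[OF i(1) j]] by (simp add: spl_def idx(2)[OF i(1) j])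
      qed
      \<comment> \<open>The last vertex of the edge is marked and the first is not; they are
        different positions because \<open>k \<ge> 2\<close>.\<close>
      have "row 0 (ms ! i ! 0) \<noteq> row 0 (ms ! i ! (k - 1))"
        using row(1)[of 0] row(1)[of "k - 1"] G(2) by simp
      then have "\<not> monochromatic (row 0) f"
        unfolding monochromatic_def using row(2)[of 0] row(2)[of "k - 1"] G(2) by fastforce
      moreover have "row 0 \<in> set (output_bicolorings n (R, A'))"
        unfolding out set_map set_upt by (intro imageI) simp
      ultimately show ?thesis by blast
    qed
  qed
  moreover have "real (length (output_bicolorings n (R, A'))) \<le> log 2 (real (card M)) + 2"
    using L(4) by (simp add: out m)
  moreover have "real t \<le> 140 * real n * max 1 (log 2 (real (card M)))"
  proof -
    have "1 \<le> L * n" "k \<le> L * n" "k * m \<le> L * n" "L \<le> L * n"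
      using L(3) n0 \<open>k \<le> n\<close> km by (auto intro: order.trans[of _ n] simp: Suc_le_eq)
    \<comment> \<open>Every term is at most its coefficient times \<open>L * n\<close>, and the
      coefficients 25, 6, 7, 15, 15 add up to 68.\<close>
    then have "t \<le> 70 * (L * n)" using t by linarith
    then have "real t \<le> real (70 * (L * n))" by (simp only: of_nat_le_iff)
    also have "\<dots> = 70 * real n * real L" by simp
    \<comment> \<open>\<open>L \<le> log 2 m + 1\<close> is at most twice the maximum; the maximum
      with 1 covers \<open>m = 1\<close>, where the logarithm vanishes. This doubles 70 to
      140.\<close>
    also have "\<dots> \<le> 70 * real n * (2 * max 1 (log 2 (real (card M))))"
      using L(4) by (intro mult_left_mono) (auto simp: m)
    finally show ?thesis by simp
  qed
  ultimately show ?thesis using that ex by blast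
qed

theorem theorem2:
  shows "(\<forall>(V :: 'a set) E M k n.
            uniform_hypergraph k V E \<and> 2 \<le> k \<and> card V = n \<and> E \<noteq> {} \<and> maximal_matching E M
            \<longrightarrow> real (bicoloring_cover_number V E) \<le> log 2 (real (card M)) + 2)
       \<and> (\<exists>(P :: prog) (C :: real). \<forall>n k (E :: nat set set) M es ms.
            uniform_hypergraph k {..<n} E \<and> 2 \<le> k \<and> E \<noteq> {} \<and> maximal_matching E M
            \<and> lists_hyperedges es E \<and> lists_hyperedges ms M
            \<longrightarrow> (\<exists>t s. exec P (initial_state (input_list n k es ms)) t s
                   \<and> bicoloring_cover {..<n} E (set (output_bicolorings n s))
                   \<and> real (length (output_bicolorings n s)) \<le> log 2 (real (card M)) + 2
                   \<and> real t \<le> C * real n * max 1 (log 2 (real (card M)))))"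
proof (rule conjI; (rule exI[of _ cover_program], rule exI[of _ 140])?; intro allI impI; elim conjE)
  fix V :: "'a set" and E M k n
  assume G: "uniform_hypergraph k V E" "2 \<le> k" "E \<noteq> {}" and M: "maximal_matching E M"
  obtain \<X> where \<X>: "finite \<X>" "bicoloring_cover V E \<X>"
      "real (card \<X>) \<le> log 2 (real (card M)) + 2"
    using bicoloring_cover_exists[OF G(1,2) M maximal_matching_nonempty[OF M G(3)]] by blast
  then have "bicoloring_cover_number V E \<le> card \<X>"
    unfolding bicoloring_cover_number_def by (intro Least_le) blast
  with \<X>(3) show "real (bicoloring_cover_number V E) \<le> log 2 (real (card M)) + 2" by linarith
qed (metis cover_program_covers)

end
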